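(* Let $G=(V,E)$ be a directed graph with $V=\{v_1,v_2,\ldots,v_n\}$, let $L=(L_{ij})$ be its latin matrix, i.e. the $n\times n$ matrix of distinguished languages over the alphabet $\Sigma=V$ given by $L_{ij}=\{\lambda, v_iv_j\}$ if $(v_i,v_j)\in E$ and $L_{ij}=\{\lambda\}$ if $(v_i,v_j)\notin E$. Let $L^{[k]}=(L^{[k]}_{ij})$ be defined by $L^{[1]}=L$ and $L^{[k]}=L\circ_\ell L^{[k-1]}$ for $k\ge 2$, that is, $$L^{[k]}_{ij}=\bigcup_{m=1}^{n}\bigl(L_{im}\circ_\ell L^{[k-1]}_{mj}\bigr).$$ Then, identifying a path $(u_1,u_2,\ldots,u_{k+1})$ in $G$ with the word $u_1u_2\cdots u_{k+1}$ over $V$ and disregarding the empty word $\lambda$ (so that $L^{[k]}_{ij}=X$ means $L^{[k]}_{ij}\setminus\{\lambda\}$ is exactly the set of words of the paths in $X$), one has $$L^{[k]}_{ij}=P_{elem}(v_i,v_j,k)\quad\text{for all } i,j\in\{1,\ldots,n\},\ i\ne j,\ 1\le k\le n-1,$$ $$L^{[k]}_{ii}=C_{elem}(v_i,k)\quad\text{for all } i\in\{1,\ldots,n\},\ 1\le k\le n.$$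
   Context: Directed graphs: $V$ is a finite set and $E\subseteq V\times V$ (loops allowed). A path from $u$ to $v$ of length $k\ge 1$ is a sequence of vertices $(u_1,\ldots,u_{k+1})$ with $u_1=u$, $u_{k+1}=v$ and $(u_i,u_{i+1})\in E$ for $i=1,\ldots,k$. It is an elementary path if $u_1,\ldots,u_{k+1}$ are pairwise distinct. A circuit of length $k\ge1$ starting at $u_1$ is a path $(u_1,\ldots,u_k,u_1)$ of length $k$; it is an elementary circuit if $u_1,\ldots,u_k$ are pairwise distinct (for $k=1$, a loop $(u_1,u_1)$ with $(u_1,u_1)\in E$ is an elementary circuit). $P_{elem}(u,v,k)$, for $u\neq v$, is the set of all elementary paths of length $k$ from $u$ to $v$; $C_{elem}(u,k)$ is the set of all elementary circuits of length $k$ starting at $u$. Words: let $\Sigma$ be an alphabet with $n$ symbols and $\lambda$ the empty word. A simple word of length $k$ ($1\le k\le n$) is a word $a_1\cdots a_k$ over $\Sigma$ with pairwise distinct symbols. A simple cyclic word of length $k+1$ ($1\le k\le n$) is a word $a_1a_2\cdots a_ka_1$ such that $a_1\cdots a_k$ is a simple word (for $k=1$: words $aa$). A distinguished word is a simple word or a simple cyclic word; $\Sigma_{dw}^*$ is the set of distinguished words together with $\lambda$. Latin composition $\circ_\ell$ on $\Sigma_{dw}^*$: $\lambda\circ_\ell x=x\circ_\ell\lambda=\lambda$ for every $x\in\Sigma_{dw}^*$; $c\circ_\ell x=x\circ_\ell c=\lambda$ for every simple cyclic word $c$ and every $x\in\Sigma_{dw}^*$; and for simple words $x=a_1\cdots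 a_k$, $y=b_1\cdots b_r$: (1) $x\circ_\ell y=a_1\cdots a_kb_2\cdots b_r$ if $a_k=b_1$ and $\{a_1,\ldots,a_k\}\cap\{b_2,\ldots,b_r\}=\emptyset$; (2) $x\circ_\ell y=a_1\cdots a_kb_2\cdots b_{r-1}a_1$ if case (1) does not apply, $a_k=b_1$, $b_r=a_1$ and $\{a_1,\ldots,a_k\}\cap\{b_2,\ldots,b_{r-1}\}=\emptyset$; (3) $x\circ_\ell y=\lambda$ otherwise. A distinguished language is a subset of $\Sigma_{dw}^*$ containing $\lambda$. For distinguished languages $L_1,L_2$, $L_1\circ_\ell L_2=\{x\circ_\ell y: x\in L_1,\ y\in L_2\}$. *)

theory Defs
  imports "Graph_Theory.Graph_Theory"
begin

section \<open>Elementary paths and circuits\<close>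

text \<open>
  A directed graph with finite vertex set \<open>V = pverts G\<close> and edge set
  \<open>E = parcs G \<subseteq> V \<times> V\<close>, loops allowed, is a \<open>pair_fin_digraph\<close>.
  The paths are the vertex walks of the library with at least one edge
  (a vertex walk may also consist of a single vertex).
\<close>

definition paths :: "'a pair_pre_digraph \<Rightarrow> 'a \<Rightarrow> 'a \<Rightarrow> nat \<Rightarrow> 'a list set" where
  "paths G u v k =
     {p. k \<ge> 1 \<and> vwalk p (with_proj G) \<and> vwalk_length p = k \<and> hd p = u \<and> last p = v}"

definition P_elem :: "'a pair_pre_digraph \<Rightarrow> 'a \<Rightarrow> 'a \<Rightarrow> nat \<Rightarrow> 'a list set" where
  "P_elem G u v k = {p \<in> paths G u v k. distinct p}"

definition C_elem :: "'a pair_pre_digraph \<Rightarrow> 'a \<Rightarrow> nat \<Rightarrow> 'a list set" where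
  "C_elem G u k = {p \<in> paths G u u k. distinct (butlast p)}"


section \<open>Distinguished words and languages\<close>

text \<open>
  Words are lists and the empty word is \<open>[]\<close>. A simple word over a finite alphabet
  with \<open>n\<close> symbols automatically has length at most \<open>n\<close>.
\<close>

definition simple_word :: "'a list \<Rightarrow> bool" where
  "simple_word w \<longleftrightarrow> w \<noteq> [] \<and> distinct w"

definition simple_cyclic_word :: "'a list \<Rightarrow> bool" where
  "simple_cyclic_word w \<longleftrightarrow> (\<exists>s. simple_word s \<and> w = s @ [hd s])"

definition distinguished_words :: "'a set \<Rightarrow> 'a list set" where
  "distinguished_words \<Sigma> =
     {w \<in> lists \<Sigma>. simple_word w \<or> simple_cyclic_word w} \<union> {[]}"

definition distinguished_language :: "'a set \<Rightarrow> 'a list set \<Rightarrow> bool" where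
  "distinguished_language \<Sigma> X \<longleftrightarrow> X \<subseteq> distinguished_words \<Sigma> \<and> [] \<in> X"


section \<open>Latin composition\<close>

text \<open>
  On distinguished words, failing to be simple means being empty or simple cyclic, and
  in these cases the composition is empty. For words that are not distinguished
  (where the composition is not defined mathematically) the value is also empty.
  With \<open>x = a\<^sub>1\<dots>a\<^sub>k\<close> and \<open>y = b\<^sub>1\<dots>b\<^sub>r\<close>, the word \<open>b\<^sub>2\<dots>b\<^sub>r\<close> is \<open>tl y\<close> and
  \<open>b\<^sub>2\<dots>b\<^sub>r\<^sub>-\<^sub>1\<close> is \<open>butlast (tl y)\<close>.
\<close>

definition latin_comp :: "'a list \<Rightarrow> 'a list \<Rightarrow> 'a list"  (infixr "\<circ>\<^sub>l" 70) where
  "x \<circ>\<^sub>l y =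
     (if \<not> simple_word x \<or> \<not> simple_word y then []
      else if last x = hd y \<and> set x \<inter> set (tl y) = {}
        then x @ tl y
      else if last x = hd y \<and> last y = hd x \<and> set x \<inter> set (butlast (tl y)) = {}
        then x @ butlast (tl y) @ [hd x]
      else [])"

definition lang_comp :: "'a list set \<Rightarrow> 'a list set \<Rightarrow> 'a list set"  (infixr "\<circ>\<^sub>L" 70) where
  "X \<circ>\<^sub>L Y = {x \<circ>\<^sub>l y | x y. x \<in> X \<and> y \<in> Y}"


section \<open>Matrices of distinguished languages\<close>

text \<open>
  An \<open>n \<times> n\<close> matrix is a function of two indices, of which only the values at
  indices in \<open>{1..n}\<close> matter.
\<close>

definition latin_matrix ::
    "'a pair_pre_digraph \<Rightarrow> (nat \<Rightarrow> 'a) \<Rightarrow> nat \<Rightarrow> nat \<Rightarrow> 'a list set" where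
  "latin_matrix G v i j = (if (v i, v j) \<in> parcs G then {[], [v i, v j]} else {[]})"

definition matrix_comp ::
    "nat \<Rightarrow> (nat \<Rightarrow> nat \<Rightarrow> 'a list set) \<Rightarrow> (nat \<Rightarrow> nat \<Rightarrow> 'a list set)
      \<Rightarrow> nat \<Rightarrow> nat \<Rightarrow> 'a list set" where
  "matrix_comp n A B i j = (\<Union>m\<in>{1..n}. A i m \<circ>\<^sub>L B m j)"

text \<open>The powers start at exponent 1; exponent 0 is left unspecified.\<close>

fun latin_power ::
    "nat \<Rightarrow> (nat \<Rightarrow> nat \<Rightarrow> 'a list set) \<Rightarrow> nat \<Rightarrow> nat \<Rightarrow> nat \<Rightarrow> 'a list set" where
  "latin_power n L (Suc 0) = L"
| "latin_power n L (Suc (Suc k)) = matrix_comp n L (latin_power n L (Suc k))"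


section \<open>Well-definedness\<close>

lemma latin_comp_distinguished:
  assumes "x \<in> distinguished_words \<Sigma>" "y \<in> distinguished_words \<Sigma>"
  shows "x \<circ>\<^sub>l y \<in> distinguished_words \<Sigma>"
proof -
  have sub: "set x \<subseteq> \<Sigma>" "set y \<subseteq> \<Sigma>"
    using assms by (auto simp: distinguished_words_def)
  have tl_sub: "set (tl y) \<subseteq> set y"
    by (cases y) auto
  consider (1) "x \<circ>\<^sub>l y = []"
    | (2) "simple_word x" "simple_word y" "set x \<inter> set (tl y) = {}" "x \<circ>\<^sub>l y = x @ tl y"
    | (3) "simple_word x" "simple_word y" "set x \<inter> set (butlast (tl y)) = {}"
          "x \<circ>\<^sub>l y = x @ butlast (tl y) @ [hd x]"
    unfolding latin_comp_def by metis
  then show ?thesis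
  proof cases
    case 1
    then show ?thesis by (simp add: distinguished_words_def)
  next
    case 2
    then have "simple_word (x @ tl y)"
      by (auto simp: simple_word_def distinct_tl)
    moreover have "set (x @ tl y) \<subseteq> \<Sigma>"
      using sub tl_sub by auto
    ultimately show ?thesis
      using 2 by (auto simp: distinguished_words_def)
  next
    case 3
    let ?s = "x @ butlast (tl y)"
    have "simple_word ?s"
      using 3 by (auto simp: simple_word_def distinct_tl distinct_butlast)
    moreover have "x \<circ>\<^sub>l y = ?s @ [hd ?s]"
      using 3 by (simp add: simple_word_def)
    ultimately have "simple_cyclic_word (x \<circ>\<^sub>l y)"
      unfolding simple_cyclic_word_def by blast
    moreover have "set (x \<circ>\<^sub>l y) \<subseteq> \<Sigma>"
    proof -
      have "hd x \<in> set x" using 3 by (simp add: simple_word_def)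
      moreover have "set (butlast (tl y)) \<subseteq> set y"
        using tl_sub by (auto dest: in_set_butlastD)
      ultimately show ?thesis using sub 3 by auto
    qed
    ultimately show ?thesis
      by (auto simp: distinguished_words_def)
  qed
qed

lemma lang_comp_distinguished:
  assumes "distinguished_language \<Sigma> X" "distinguished_language \<Sigma> Y"
  shows "distinguished_language \<Sigma> (X \<circ>\<^sub>L Y)"
proof -
  have "[] = [] \<circ>\<^sub>l []" by (simp add: latin_comp_def simple_word_def)
  then show ?thesis
    using assms latin_comp_distinguished
    unfolding distinguished_language_def lang_comp_def by blast
qed

lemma latin_matrix_distinguished:
  assumes "pair_wf_digraph G"
  shows "distinguished_language (pverts G) (latin_matrix G v i j)"
proof -
  have "simple_word [v i, v j] \<or> simple_cyclic_word [v i, v j]"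
  proof (cases "v i = v j")
    case True
    then have "simple_word [v i] \<and> [v i, v j] = [v i] @ [hd [v i]]"
      by (simp add: simple_word_def)
    then show ?thesis unfolding simple_cyclic_word_def by blast
  qed (simp add: simple_word_def)
  moreover have "v i \<in> pverts G" "v j \<in> pverts G" if "(v i, v j) \<in> parcs G"
    using assms that by (auto dest: pair_wf_digraph.in_arcsD1 pair_wf_digraph.in_arcsD2)
  ultimately show ?thesis
    by (auto simp: distinguished_language_def distinguished_words_def latin_matrix_def)
qed

lemma latin_power_distinguished:
  assumes "\<And>i j. distinguished_language \<Sigma> (L i j)" "n \<ge> 1" "k \<ge> 1"
  shows "distinguished_language \<Sigma> (latin_power n L k i j)"
  using \<open>k \<ge> 1\<close>
proof (induction k arbitrary: i j rule: dec_induct)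
  case base
  then show ?case using assms(1) by simp
next
  case (step k)
  then obtain l where k: "k = Suc l" by (cases k) auto
  have *: "distinguished_language \<Sigma> (L i m \<circ>\<^sub>L latin_power n L k m j)" for m
    using assms(1) step.IH by (rule lang_comp_distinguished)
  have "1 \<in> {1..n}" using assms(2) by simp
  then have "distinguished_language \<Sigma> (matrix_comp n L (latin_power n L k) i j)"
    using * unfolding matrix_comp_def distinguished_language_def by blast
  then show ?case by (simp add: k)
qed

end

theory Submission
  imports Defs
begin

text \<open>
  Composing an edge \<open>um\<close> with a simple word \<open>y\<close> starting at \<open>m\<close> gives \<open>uy\<close> if \<open>u\<close> does not
  occur in \<open>y\<close> except possibly as its last letter, and the empty word otherwise; the two cases
  of the latin composition thus merge into one. Removing the first vertex of an elementary path
  or circuit always leaves an elementary path, so both satisfy the same recursion in the length.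
\<close>

text \<open>Keying one family by the endpoints lets a single induction treat all matrix entries: a
  diagonal entry of one power is computed from off-diagonal entries of the previous power.\<close>

definition elementary_words :: "'a pair_pre_digraph \<Rightarrow> 'a \<Rightarrow> 'a \<Rightarrow> nat \<Rightarrow> 'a list set" where
  "elementary_words G u w k = (if u = w then C_elem G u k else P_elem G u w k)"

lemma mem_elementary_words_iff:
  "p \<in> elementary_words G u w k \<longleftrightarrow>
     p \<in> paths G u w k \<and> distinct (butlast p) \<and> (u \<noteq> w \<longrightarrow> distinct p)"
  by (auto simp: elementary_words_def C_elem_def P_elem_def distinct_butlast)

text \<open>Write \<open>y = m b l\<close>. Under the stated condition, \<open>l \<noteq> u\<close>
  leads to case (1) and \<open>l = u\<close> to case (2), and both results spell
  \<open>u # y\<close>. Since \<open>y\<close> has at least two letters, \<open>m\<close> lies in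
  \<open>butlast y\<close>, so the condition also rejects \<open>u = m\<close>, where
  \<open>[u, m]\<close> is not simple.\<close>

lemma latin_comp_edge:
  assumes "length y \<ge> 2"
  shows "[u, hd y] \<circ>\<^sub>l y = (if distinct y \<and> u \<notin> set (butlast y) then u # y else [])"
proof -
  obtain m z where yz: "y = m # z"
    using assms by (cases y) auto
  then obtain b l where "z = b @ [l]"
    using assms by (cases z rule: rev_cases) auto
  with yz have y: "y = m # b @ [l]"
    by simp
  show ?thesis
    by (auto simp: y latin_comp_def simple_word_def)
qed

lemma latin_comp_nonempty_simple:
  "x \<circ>\<^sub>l y \<noteq> [] \<Longrightarrow> simple_word x \<and> simple_word y"
  by (auto simp: latin_comp_def split: if_splits)

lemma mem_paths_iff:
  assumes "k \<ge> 1"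
  shows "p \<in> paths G u w k \<longleftrightarrow>
     vwalk p (with_proj G) \<and> length p = Suc k \<and> hd p = u \<and> last p = w"
  using assms by (cases p) (auto simp: paths_def)

text \<open>The case \<open>m = w\<close> is harmless: such a \<open>y\<close> is a circuit, so its
  first and last letters agree and \<open>distinct y\<close> discards it.\<close>

lemma elementary_words_Suc:
  assumes "pair_wf_digraph G" "k \<ge> 1"
  shows "elementary_words G u w (Suc k) =
     {u # y | y m. (u, m) \<in> parcs G \<and> y \<in> elementary_words G m w k
        \<and> distinct y \<and> u \<notin> set (butlast y)}" (is "_ = ?R")
proof (intro set_eqI)
  interpret pair_wf_digraph G by fact
  fix p
  have walk: "vwalk (u # y) (with_proj G) \<longleftrightarrow> (u, hd y) \<in> parcs G \<and> vwalk y (with_proj G)"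
    if "y \<noteq> []" for y
    using that by (auto simp: vwalk_def in_arcsD1)
  have cons: "u # y \<in> elementary_words G u w (Suc k) \<longleftrightarrow>
      (u, hd y) \<in> parcs G \<and> y \<in> elementary_words G (hd y) w k
        \<and> distinct y \<and> u \<notin> set (butlast y)" for y
  proof (cases "length y = Suc k \<and> last y = w")
    case False
    then show ?thesis
      using assms by (auto simp: mem_elementary_words_iff mem_paths_iff)
  next
    case True
    then have ne: "y \<noteq> []" by auto
    \<comment> \<open>Now \<open>butlast (u # y)\<close> is \<open>u # b\<close>. If
      \<open>u = w\<close>, distinctness of \<open>u # b\<close> already keeps \<open>w\<close> out
      of \<open>b\<close>, so \<open>y\<close> is distinct; if \<open>u \<noteq> w\<close>, all of
      \<open>u # y\<close> is distinct.\<close>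
    then obtain b where y: "y = b @ [w]"
      using True by (metis append_butlast_last_id)
    show ?thesis
      using assms True ne walk[OF ne]
      by (auto simp: mem_elementary_words_iff mem_paths_iff y)
  qed
  have "hd y = m" if "y \<in> elementary_words G m w k" for y m
    using that assms by (simp add: mem_elementary_words_iff mem_paths_iff)
  moreover have "\<exists>y. p = u # y" if "p \<in> elementary_words G u w (Suc k)"
    using that by (cases p) (auto simp: mem_elementary_words_iff mem_paths_iff)
  ultimately show "p \<in> elementary_words G u w (Suc k) \<longleftrightarrow> p \<in> ?R"
    using cons by blast
qed

lemma elementary_words_1:
  assumes "pair_wf_digraph G"
  shows "elementary_words G u w 1 = (if (u, w) \<in> parcs G then {[u, w]} else {})"
proof -
  interpret pair_wf_digraph G by fact
  have "p \<in> elementary_words G u w 1 \<longleftrightarrow> (u, w) \<in> parcs G \<and> p = [u, w]" for p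
    by (auto simp: mem_elementary_words_iff mem_paths_iff length_Suc_conv vwalk_def
        intro: in_arcsD1 in_arcsD2)
  then show ?thesis by auto
qed

lemma latin_power_eq_elementary_words:
  assumes wf: "pair_wf_digraph G" and v: "v ` {1..n} = pverts G"
    and "k \<ge> 1"
  shows "latin_power n (latin_matrix G v) k i j - {[]} = elementary_words G (v i) (v j) k"
  using \<open>k \<ge> 1\<close>
\<comment> \<open>The start index must vary while \<open>j\<close> stays fixed, because the
  recursion removes the first vertex only.\<close>
proof (induction k arbitrary: i rule: nat_induct_at_least)
  case base
  then show ?case
    using elementary_words_1[OF wf] by (simp add: latin_matrix_def)
next
  case (Suc k)
  interpret pair_wf_digraph G by (fact wf)
  let ?L = "latin_matrix G v" and ?E = "elementary_words G"
  have pow: "latin_power n ?L (Suc k) = matrix_comp n ?L (latin_power n ?L k)"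
    using Suc.hyps by (cases k) auto
  have elem: "length y \<ge> 2 \<and> hd y = u" if "y \<in> ?E u w k" for y u w
    using that Suc.hyps by (simp add: mem_elementary_words_iff mem_paths_iff)
  have edge: "[u, m] \<circ>\<^sub>l y = (if distinct y \<and> u \<notin> set (butlast y) then u # y else [])"
    if "y \<in> ?E m w k" for u m w y
    using latin_comp_edge elem[OF that] by metis
  have "p \<in> matrix_comp n ?L (latin_power n ?L k) i j - {[]} \<longleftrightarrow>
      p \<in> ?E (v i) (v j) (Suc k)" for p
  proof
    assume p: "p \<in> matrix_comp n ?L (latin_power n ?L k) i j - {[]}"
    then obtain m x y where xy: "x \<in> ?L i m" "y \<in> latin_power n ?L k m j" "p = x \<circ>\<^sub>l y"
      by (auto simp: matrix_comp_def lang_comp_def)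
    \<comment> \<open>The empty word absorbs under composition, so a nonempty \<open>p\<close> has
      nonempty factors, and the induction hypothesis applies to \<open>y\<close>.\<close>
    then have ne: "x \<noteq> []" "y \<noteq> []"
      using p latin_comp_nonempty_simple by (fastforce simp: simple_word_def)+
    then have "y \<in> ?E (v m) (v j) k"
      using xy(2) Suc.IH by blast
    moreover have "(v i, v m) \<in> parcs G" "x = [v i, v m]"
      using xy(1) ne by (auto simp: latin_matrix_def split: if_splits)
    ultimately show "p \<in> ?E (v i) (v j) (Suc k)"
      using p xy(3) edge elementary_words_Suc[OF wf Suc.hyps]
      by (auto split: if_splits)
  next
    assume "p \<in> ?E (v i) (v j) (Suc k)"
    then obtain y w where y: "p = v i # y" "(v i, w) \<in> parcs G" "y \<in> ?E w (v j) k"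
        "distinct y" "v i \<notin> set (butlast y)"
      using elementary_words_Suc[OF wf Suc.hyps] by auto
    \<comment> \<open>Surjectivity of \<open>v\<close> supplies the index of the second vertex,
      which selects the member of the union containing \<open>p\<close>.\<close>
    then obtain m where m: "m \<in> {1..n}" "w = v m"
      using v in_arcsD2 by blast
    have "y \<in> latin_power n ?L k m j"
      using y(3) m(2) Suc.IH by blast
    moreover have "[v i, v m] \<in> ?L i m"
      using y(2) m(2) by (simp add: latin_matrix_def)
    moreover have "p = [v i, v m] \<circ>\<^sub>l y"
      using edge y m by simp
    ultimately show "p \<in> matrix_comp n ?L (latin_power n ?L k) i j - {[]}"
      using m y(1) unfolding matrix_comp_def lang_comp_def by blast
  qed
  then show ?case
    unfolding pow by blast
qed

theorem theorem4p1:
  fixes G :: "'a pair_pre_digraph" and n :: nat and v :: "nat \<Rightarrow> 'a"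
  assumes "pair_fin_digraph G"
    and "bij_betw v {1..n} (pverts G)"
  shows "(\<forall>i\<in>{1..n}. \<forall>j\<in>{1..n}. \<forall>k\<in>{1..n - 1}. i \<noteq> j \<longrightarrow>
            latin_power n (latin_matrix G v) k i j - {[]} = P_elem G (v i) (v j) k)
       \<and> (\<forall>i\<in>{1..n}. \<forall>k\<in>{1..n}.
            latin_power n (latin_matrix G v) k i i - {[]} = C_elem G (v i) k)"
proof -
  interpret pair_fin_digraph G by fact
  have pow: "latin_power n (latin_matrix G v) k i j - {[]} = elementary_words G (v i) (v j) k"
    if "k \<ge> 1" for i j k
    using bij_betw_imp_surj_on[OF assms(2)] that
    by (rule latin_power_eq_elementary_words[OF pair_wf_digraph_axioms])
  \<comment> \<open>Injectivity turns distinct indices into distinct vertices, which selects the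
    path branch of \<open>elementary_words\<close>.\<close>
  have neq: "v i \<noteq> v j" if "i \<in> {1..n}" "j \<in> {1..n}" "i \<noteq> j" for i j
    using bij_betw_imp_inj_on[OF assms(2)] that by (meson inj_on_contraD)
  show ?thesis
  proof (intro conjI ballI impI)
    fix i j k
    assume "i \<in> {1..n}" "j \<in> {1..n}" "k \<in> {1..n - 1}" "i \<noteq> j"
    then show "latin_power n (latin_matrix G v) k i j - {[]} = P_elem G (v i) (v j) k"
      using pow[of k i j] neq[of i j] by (simp add: elementary_words_def)
  next
    fix i k
    assume "k \<in> {1..n}"
    then show "latin_power n (latin_matrix G v) k i i - {[]} = C_elem G (v i) k"
      using pow[of k i i] by (simp add: elementary_words_def)
  qed
qed

end
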